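(* Let $k\ge2$ be an integer. The mixing time of the commuting chain on $PSL(2,2^k)$ satisfies \[\frac{2^k+1}{4}\le t_{mix}\le\left\lceil (2^k+1)\log(16)+2\right\rceil .\] Furthermore, the sequence of commuting chains on $PSL(2,2^k)$ (as $k\to\infty$) does not exhibit cutoff.
   Context: $PSL(2,2^k)$ is the quotient of $SL(2,2^k)$ ($2\times2$ matrices of determinant $1$ over the field with $2^k$ elements) by its subgroup of scalar matrices. For a finite group $G$ and $x\in G$, let $C_x=\{h\in G: hx=xh\}$ and let $x^G$ be the conjugacy class of $x$. The commuting chain on $G$ is the Markov chain with state space $G$ and transition matrix $P(x,y)=\frac{1}{|C_x|}\mathbf 1_{\{xy=yx\}}$; its stationary distribution is $\pi(x)=\frac{1}{\kappa|x^G|}$, where $\kappa$ is the number of conjugacy classes of $G$. Total variation distance: $\Vert\mu-\nu\Vert_{TV}=\sup_{A}|\mu(A)-\nu(A)|$. Put $d(t)=\max_x\Vert P^t(x,\cdot)-\pi\Vert_{TV}$, $t_{mix}(\varepsilon)=\min\{t: d(t)\le\varepsilon\}$, and $t_{mix}=t_{mix}(1/4)$. A sequence of chains indexed by a parameter $n\to\infty$ with mixing times $t^{(n)}_{mix}(\varepsilon)$ exhibits cutoff if $\lim_{n\to\infty} t^{(n)}_{mix}(\varepsilon)/t^{(n)}_{mix}(1-\varepsilon)=1$ for all $\varepsilon\in(0,1)$. $\log$ is the natural logarithm. *)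

theory Defs
  imports Complex_Main "HOL-Algebra.Coset" "HOL-Algebra.Ring"
begin

text \<open>
  A chain is given by a finite state space \<open>S\<close>, a transition matrix \<open>P\<close> and a
  stationary distribution \<open>\<pi>\<close>. Matrices and distributions are total functions whose values
  outside \<open>S\<close> are irrelevant.
\<close>

primrec transition_power ::
  "'s set \<Rightarrow> ('s \<Rightarrow> 's \<Rightarrow> real) \<Rightarrow> nat \<Rightarrow> 's \<Rightarrow> 's \<Rightarrow> real" where
  "transition_power S P 0 x y = (if x = y then 1 else 0)"
| "transition_power S P (Suc t) x y = (\<Sum>z\<in>S. transition_power S P t x z * P z y)"

definition tv_dist :: "'s set \<Rightarrow> ('s \<Rightarrow> real) \<Rightarrow> ('s \<Rightarrow> real) \<Rightarrow> real" where
  "tv_dist S \<mu> \<nu> = (SUP A\<in>Pow S. \<bar>(\<Sum>x\<in>A. \<mu> x) - (\<Sum>x\<in>A. \<nu> x)\<bar>)"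

definition mixing_dist ::
  "'s set \<Rightarrow> ('s \<Rightarrow> 's \<Rightarrow> real) \<Rightarrow> ('s \<Rightarrow> real) \<Rightarrow> nat \<Rightarrow> real" where
  "mixing_dist S P \<pi> t = (MAX x\<in>S. tv_dist S (transition_power S P t x) \<pi>)"

definition mixing_time ::
  "'s set \<Rightarrow> ('s \<Rightarrow> 's \<Rightarrow> real) \<Rightarrow> ('s \<Rightarrow> real) \<Rightarrow> real \<Rightarrow> nat" where
  "mixing_time S P \<pi> \<epsilon> = (LEAST t. mixing_dist S P \<pi> t \<le> \<epsilon>)"

text \<open>
  Here \<open>t n \<epsilon>\<close> is the \<open>\<epsilon>\<close>-mixing time of the \<open>n\<close>-th chain; being a
  limit property, cutoff does not depend on any initial segment of the sequence.
\<close>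

definition exhibits_cutoff :: "(nat \<Rightarrow> real \<Rightarrow> nat) \<Rightarrow> bool" where
  "exhibits_cutoff t \<longleftrightarrow>
     (\<forall>\<epsilon>\<in>{0<..<1}. (\<lambda>n. real (t n \<epsilon>) / real (t n (1 - \<epsilon>))) \<longlonglongrightarrow> 1)"

definition centralizer_of :: "('a, 'b) monoid_scheme \<Rightarrow> 'a \<Rightarrow> 'a set" where
  "centralizer_of G x = {h \<in> carrier G. h \<otimes>\<^bsub>G\<^esub> x = x \<otimes>\<^bsub>G\<^esub> h}"

definition conj_class :: "('a, 'b) monoid_scheme \<Rightarrow> 'a \<Rightarrow> 'a set" where
  "conj_class G x = {g \<otimes>\<^bsub>G\<^esub> x \<otimes>\<^bsub>G\<^esub> inv\<^bsub>G\<^esub> g | g. g \<in> carrier G}"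

definition num_conj_classes :: "('a, 'b) monoid_scheme \<Rightarrow> nat" where
  "num_conj_classes G = card (conj_class G ` carrier G)"

definition commuting_matrix :: "('a, 'b) monoid_scheme \<Rightarrow> 'a \<Rightarrow> 'a \<Rightarrow> real" where
  "commuting_matrix G x y =
     (if x \<otimes>\<^bsub>G\<^esub> y = y \<otimes>\<^bsub>G\<^esub> x then 1 / real (card (centralizer_of G x)) else 0)"

definition commuting_stationary :: "('a, 'b) monoid_scheme \<Rightarrow> 'a \<Rightarrow> real" where
  "commuting_stationary G x =
     1 / (real (num_conj_classes G) * real (card (conj_class G x)))"

definition commuting_mixing_time :: "('a, 'b) monoid_scheme \<Rightarrow> real \<Rightarrow> nat" where
  "commuting_mixing_time G \<epsilon> =
     mixing_time (carrier G) (commuting_matrix G) (commuting_stationary G) \<epsilon>"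

text \<open>
  The quadruple \<open>(a, b, c, d)\<close> is the \<open>2 \<times> 2\<close> matrix with first row
  \<open>(a, b)\<close> and second row \<open>(c, d)\<close>.
\<close>

type_synonym 'a mat2 = "'a \<times> 'a \<times> 'a \<times> 'a"

fun mat2_mult :: "('a, 'm) ring_scheme \<Rightarrow> 'a mat2 \<Rightarrow> 'a mat2 \<Rightarrow> 'a mat2" where
  "mat2_mult R (a, b, c, d) (a', b', c', d') =
     (a \<otimes>\<^bsub>R\<^esub> a' \<oplus>\<^bsub>R\<^esub> b \<otimes>\<^bsub>R\<^esub> c', a \<otimes>\<^bsub>R\<^esub> b' \<oplus>\<^bsub>R\<^esub> b \<otimes>\<^bsub>R\<^esub> d',
      c \<otimes>\<^bsub>R\<^esub> a' \<oplus>\<^bsub>R\<^esub> d \<otimes>\<^bsub>R\<^esub> c', c \<otimes>\<^bsub>R\<^esub> b' \<oplus>\<^bsub>R\<^esub> d \<otimes>\<^bsub>R\<^esub> d')"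

fun mat2_det :: "('a, 'm) ring_scheme \<Rightarrow> 'a mat2 \<Rightarrow> 'a" where
  "mat2_det R (a, b, c, d) = a \<otimes>\<^bsub>R\<^esub> d \<ominus>\<^bsub>R\<^esub> b \<otimes>\<^bsub>R\<^esub> c"

definition SL2 :: "('a, 'm) ring_scheme \<Rightarrow> 'a mat2 monoid" where
  "SL2 R =
     \<lparr>carrier = {A \<in> carrier R \<times> carrier R \<times> carrier R \<times> carrier R. mat2_det R A = \<one>\<^bsub>R\<^esub>},
      mult = mat2_mult R,
      one = (\<one>\<^bsub>R\<^esub>, \<zero>\<^bsub>R\<^esub>, \<zero>\<^bsub>R\<^esub>, \<one>\<^bsub>R\<^esub>)\<rparr>"

definition scalar_SL2 :: "('a, 'm) ring_scheme \<Rightarrow> 'a mat2 set" where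
  "scalar_SL2 R = {(a, \<zero>\<^bsub>R\<^esub>, \<zero>\<^bsub>R\<^esub>, a) | a. a \<in> carrier R} \<inter> carrier (SL2 R)"

definition PSL2 :: "('a, 'm) ring_scheme \<Rightarrow> 'a mat2 set monoid" where
  "PSL2 R = SL2 R Mod scalar_SL2 R"

end

theory Submission
  imports Defs "HOL-Algebra.Group_Action" "HOL-Algebra.Multiplicative_Group"
begin

text \<open>
  Put \<open>q = 2 ^ k\<close>. In characteristic 2 the only scalar matrix of determinant 1 is the identity, so
  the group is \<open>SL(2, q)\<close>, whose nontrivial centralizers have at most \<open>q + 1\<close> elements. Hence
  every nontrivial state moves to the identity with probability at least \<open>1 / (q + 1)\<close>, and the
  identity moves to a uniform element. So two steps of the chain dominate \<open>1 / (q + 1)\<close> times the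
  uniform distribution, which gives \<open>d(2 s) \<le> (1 - 1 / (q + 1)) ^ s\<close>. Conversely, the \<open>q - 1\<close>
  nontrivial elements of a unipotent centralizer have small stationary mass, and the chain leaves
  them only through the identity, so that \<open>d(t) \<ge> 1 - t / q - 1 / (q - 1)\<close>. The two estimates
  bound \<open>t_mix\<close>, and for \<open>\<epsilon> = 1 / 10\<close> they separate the mixing times at \<open>\<epsilon>\<close> and \<open>1 - \<epsilon>\<close> by
  a factor of 2, which rules out cutoff.
\<close>

section \<open>Finite Markov chains\<close>

lemma tv_dist_le:
  assumes "\<And>A. A \<subseteq> S \<Longrightarrow> \<bar>(\<Sum>x\<in>A. \<mu> x) - (\<Sum>x\<in>A. \<nu> x)\<bar> \<le> c"
  shows "tv_dist S \<mu> \<nu> \<le> c"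
  unfolding tv_dist_def using assms by (intro cSUP_least) auto

lemma tv_dist_ge:
  assumes "finite S" "A \<subseteq> S"
  shows "(\<Sum>x\<in>A. \<mu> x) - (\<Sum>x\<in>A. \<nu> x) \<le> tv_dist S \<mu> \<nu>"
proof -
  have "\<bar>(\<Sum>x\<in>A. \<mu> x) - (\<Sum>x\<in>A. \<nu> x)\<bar> \<le> tv_dist S \<mu> \<nu>"
    unfolding tv_dist_def using assms by (intro cSUP_upper) auto
  then show ?thesis by linarith
qed

locale finite_chain =
  fixes S :: "'s set" and P :: "'s \<Rightarrow> 's \<Rightarrow> real" and \<pi> :: "'s \<Rightarrow> real"
  assumes finite: "finite S"
    and nonneg: "\<And>x y. x \<in> S \<Longrightarrow> y \<in> S \<Longrightarrow> 0 \<le> P x y"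
    and row_sum: "\<And>x. x \<in> S \<Longrightarrow> (\<Sum>y\<in>S. P x y) = 1"
    and stat_nonneg: "\<And>x. x \<in> S \<Longrightarrow> 0 \<le> \<pi> x"
    and stat_sum: "(\<Sum>x\<in>S. \<pi> x) = 1"
    and stationary: "\<And>y. y \<in> S \<Longrightarrow> (\<Sum>x\<in>S. \<pi> x * P x y) = \<pi> y"
begin

text \<open>The transition operator acting on functions. Contraction is tracked through the
  oscillation of a function instead of through distributions.\<close>

definition averaging :: "('s \<Rightarrow> real) \<Rightarrow> 's \<Rightarrow> real" where
  "averaging f x = (\<Sum>y\<in>S. P x y * f y)"

lemma nonempty: "S \<noteq> {}"
  using stat_sum by auto

lemma transition_power_nonneg:
  "x \<in> S \<Longrightarrow> y \<in> S \<Longrightarrow> 0 \<le> transition_power S P t x y"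
  by (induction t arbitrary: y) (auto intro!: sum_nonneg mult_nonneg_nonneg nonneg)

text \<open>\<open>transition_power\<close> appends its last step on the right, and that step can be
  absorbed into the integrand as one application of \<open>averaging\<close>. The integrand
  therefore changes along the induction, which is why \<open>f\<close> is kept arbitrary.\<close>

lemma transition_power_integral:
  "x \<in> S \<Longrightarrow> (\<Sum>y\<in>S. transition_power S P t x y * f y) = (averaging ^^ t) f x"
proof (induction t arbitrary: f)
  case 0
  then show ?case using finite by (simp add: if_distrib[of "\<lambda>c. c * _"] cong: if_cong)
next
  case (Suc t)
  have "(\<Sum>y\<in>S. transition_power S P (Suc t) x y * f y)
      = (\<Sum>y\<in>S. \<Sum>z\<in>S. transition_power S P t x z * (P z y * f y))"
    by (simp add: sum_distrib_right mult.assoc)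
  also have "\<dots> = (\<Sum>z\<in>S. transition_power S P t x z * averaging f z)"
    by (subst sum.swap) (simp add: averaging_def sum_distrib_left)
  also have "\<dots> = (averaging ^^ Suc t) f x"
    using Suc by (simp add: funpow_swap1)
  finally show ?case .
qed

lemma averaging_stationary:
  "(\<Sum>x\<in>S. \<pi> x * averaging f x) = (\<Sum>x\<in>S. \<pi> x * f x)"
proof -
  have "(\<Sum>x\<in>S. \<pi> x * averaging f x) = (\<Sum>y\<in>S. \<Sum>x\<in>S. \<pi> x * P x y * f y)"
    by (subst sum.swap) (simp add: averaging_def sum_distrib_left mult.assoc)
  also have "\<dots> = (\<Sum>y\<in>S. \<pi> y * f y)"
    by (simp add: stationary flip: sum_distrib_right)
  finally show ?thesis .
qed

lemma iterated_averaging_stationary: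
  "(\<Sum>x\<in>S. \<pi> x * (averaging ^^ t) f x) = (\<Sum>x\<in>S. \<pi> x * f x)"
  by (induction t) (simp_all add: averaging_stationary)

section \<open>Lower bounds from a set that the chain rarely leaves\<close>

lemma mixing_dist_ge:
  assumes "x \<in> S" "A \<subseteq> S"
  shows "(\<Sum>y\<in>A. transition_power S P t x y) - (\<Sum>y\<in>A. \<pi> y) \<le> mixing_dist S P \<pi> t"
proof -
  have "tv_dist S (transition_power S P t x) \<pi> \<le> mixing_dist S P \<pi> t"
    unfolding mixing_dist_def using assms finite by (intro Max_ge) auto
  then show ?thesis
    using tv_dist_ge[OF finite assms(2), of "transition_power S P t x" \<pi>] by linarith
qed

text \<open>The mass present in \<open>A\<close> loses at most the factor \<open>c\<close> in each
  step, and whatever returns to \<open>A\<close> from outside can only help.\<close>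

lemma transition_power_stay:
  assumes "A \<subseteq> S" "x \<in> A" "0 \<le> c" and stay: "\<And>y. y \<in> A \<Longrightarrow> c \<le> (\<Sum>z\<in>A. P y z)"
  shows "c ^ t \<le> (\<Sum>y\<in>A. transition_power S P t x y)"
proof (induction t)
  case 0
  show ?case using assms finite finite_subset[of A S] by simp
next
  case (Suc t)
  have "c ^ Suc t \<le> (\<Sum>z\<in>A. transition_power S P t x z) * c"
    using Suc mult_right_mono[OF Suc \<open>0 \<le> c\<close>] by (simp add: mult.commute)
  also have "\<dots> \<le> (\<Sum>z\<in>A. transition_power S P t x z * (\<Sum>y\<in>A. P z y))"
    unfolding sum_distrib_right using assms
    by (intro sum_mono mult_left_mono stay transition_power_nonneg) auto
  \<comment> \<open>Paths that have left \<open>A\<close> and come back are added here; their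
    weights are nonnegative.\<close>
  also have "\<dots> \<le> (\<Sum>z\<in>S. transition_power S P t x z * (\<Sum>y\<in>A. P z y))"
    using assms finite
    by (intro sum_mono2 mult_nonneg_nonneg sum_nonneg nonneg transition_power_nonneg) auto
  also have "\<dots> = (\<Sum>y\<in>A. transition_power S P (Suc t) x y)"
    by (simp add: sum_distrib_left sum.swap[of _ A])
  finally show ?case .
qed

section \<open>Contraction under a two-step minorization\<close>

text \<open>Doeblin's argument. The two-step kernel splits into \<open>\<delta> * \<nu> y\<close>,
  whose contribution is the same for all starting points, and a nonnegative remainder of total mass
  \<open>1 - \<delta>\<close>. Only the remainder can make the averaged function vary.\<close>

lemma averaging_contraction:
  assumes "0 \<le> \<delta>" "\<delta> \<le> 1"
    and minor: "\<And>x y. x \<in> S \<Longrightarrow> y \<in> S \<Longrightarrow> \<delta> * \<nu> y \<le> (\<Sum>z\<in>S. P x z * P z y)"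
    and "(\<Sum>y\<in>S. \<nu> y) = 1"
    and f: "\<And>x. x \<in> S \<Longrightarrow> m \<le> f x" "\<And>x. x \<in> S \<Longrightarrow> f x \<le> m + r"
  obtains m' where "\<And>x. x \<in> S \<Longrightarrow> m' \<le> averaging (averaging f) x"
    "\<And>x. x \<in> S \<Longrightarrow> averaging (averaging f) x \<le> m' + (1 - \<delta>) * r"
proof
  define w where "w x y = (\<Sum>z\<in>S. P x z * P z y) - \<delta> * \<nu> y" for x y
  \<comment> \<open>The common contribution of \<open>\<nu>\<close>, plus the least value that the
    remainder \<open>w\<close> can contribute.\<close>
  define m' where "m' = \<delta> * (\<Sum>y\<in>S. \<nu> y * f y) + (1 - \<delta>) * m"
  fix x assume x: "x \<in> S"
  have w: "0 \<le> w x y" if "y \<in> S" for y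
    using minor[OF x that] by (simp add: w_def)
  have "(\<Sum>y\<in>S. \<Sum>z\<in>S. P x z * P z y) = (\<Sum>z\<in>S. P x z * (\<Sum>y\<in>S. P z y))"
    by (subst sum.swap) (simp add: sum_distrib_left)
  then have w_sum: "(\<Sum>y\<in>S. w x y) = 1 - \<delta>"
    using x assms(4) by (simp add: w_def sum_subtractf row_sum flip: sum_distrib_left)
  have "averaging (averaging f) x = (\<Sum>y\<in>S. \<Sum>z\<in>S. P x z * P z y * f y)"
    by (subst sum.swap) (simp add: averaging_def sum_distrib_left mult.assoc)
  also have "\<dots> = \<delta> * (\<Sum>y\<in>S. \<nu> y * f y) + (\<Sum>y\<in>S. w x y * f y)"
    by (simp add: w_def sum_distrib_right sum_distrib_left mult.assoc left_diff_distrib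
        flip: sum.distrib)
  finally have eq: "averaging (averaging f) x
      = \<delta> * (\<Sum>y\<in>S. \<nu> y * f y) + (\<Sum>y\<in>S. w x y * f y)" .
  have "(1 - \<delta>) * m \<le> (\<Sum>y\<in>S. w x y * f y)"
    unfolding w_sum[symmetric] sum_distrib_right by (intro sum_mono mult_left_mono f w)
  moreover have "(\<Sum>y\<in>S. w x y * f y) \<le> (1 - \<delta>) * (m + r)"
    unfolding w_sum[symmetric] sum_distrib_right by (intro sum_mono mult_left_mono f w)
  ultimately show "m' \<le> averaging (averaging f) x"
    and "averaging (averaging f) x \<le> m' + (1 - \<delta>) * r"
    unfolding eq m'_def by (simp_all add: algebra_simps)
qed

text \<open>Apply the contraction \<open>s\<close> times to the indicator of an event
  \<open>A\<close>. Its probability at time \<open>2 * s\<close> is a value of the resulting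
  function, and its stationary probability is a \<open>\<pi>\<close>-average of such values, so both
  lie in one interval of length \<open>(1 - \<delta>) ^ s\<close>.\<close>

lemma mixing_dist_le_minorization:
  assumes \<delta>: "0 \<le> \<delta>" "\<delta> \<le> 1"
    and minor: "\<And>x y. x \<in> S \<Longrightarrow> y \<in> S \<Longrightarrow> \<delta> * \<nu> y \<le> (\<Sum>z\<in>S. P x z * P z y)"
    and \<nu>: "(\<Sum>y\<in>S. \<nu> y) = 1"
  shows "mixing_dist S P \<pi> (2 * s) \<le> (1 - \<delta>) ^ s"
proof -
  have "tv_dist S (transition_power S P (2 * s) x) \<pi> \<le> (1 - \<delta>) ^ s" if x: "x \<in> S" for x
  proof (rule tv_dist_le)
    fix A assume A: "A \<subseteq> S"
    define f :: "'s \<Rightarrow> real" where "f x = (if x \<in> A then 1 else 0)" for x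
    \<comment> \<open>The lower end \<open>m\<close> of the interval moves with \<open>s\<close>, so
      it is quantified inside the induction.\<close>
    have "\<exists>m. \<forall>x\<in>S. m \<le> (averaging ^^ (2 * s)) f x \<and> (averaging ^^ (2 * s)) f x \<le> m + (1 - \<delta>) ^ s"
    proof (induction s)
      case 0
      show ?case by (intro exI[of _ 0]) (auto simp: f_def)
    next
      case (Suc s)
      then obtain m where m: "\<And>x. x \<in> S \<Longrightarrow> m \<le> (averaging ^^ (2 * s)) f x"
        "\<And>x. x \<in> S \<Longrightarrow> (averaging ^^ (2 * s)) f x \<le> m + (1 - \<delta>) ^ s"
        by auto
      show ?case
        by (rule averaging_contraction[OF \<delta> minor \<nu> m]) auto
    qed
    then obtain m where m: "\<And>x. x \<in> S \<Longrightarrow> m \<le> (averaging ^^ (2 * s)) f x"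
        "\<And>x. x \<in> S \<Longrightarrow> (averaging ^^ (2 * s)) f x \<le> m + (1 - \<delta>) ^ s"
      by auto
    have restrict: "(\<Sum>y\<in>S. g y * f y) = (\<Sum>y\<in>A. g y)" for g
      using A finite by (simp add: f_def sum.inter_restrict[symmetric] Int_absorb1
          if_distrib[of "\<lambda>c. _ * c"] cong: if_cong)
    have start: "(\<Sum>y\<in>A. transition_power S P (2 * s) x y) = (averaging ^^ (2 * s)) f x"
      using transition_power_integral[OF x, of "2 * s" f] by (simp add: restrict)
    have stat: "(\<Sum>y\<in>A. \<pi> y) = (\<Sum>x\<in>S. \<pi> x * (averaging ^^ (2 * s)) f x)"
      by (simp add: iterated_averaging_stationary restrict)
    have "m \<le> (\<Sum>y\<in>A. \<pi> y)"
    proof -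
      have "m = (\<Sum>x\<in>S. \<pi> x * m)" using stat_sum by (simp flip: sum_distrib_right)
      also have "\<dots> \<le> (\<Sum>y\<in>A. \<pi> y)"
        unfolding stat by (intro sum_mono mult_left_mono m stat_nonneg)
      finally show ?thesis .
    qed
    moreover have "(\<Sum>y\<in>A. \<pi> y) \<le> m + (1 - \<delta>) ^ s"
    proof -
      have "(\<Sum>y\<in>A. \<pi> y) \<le> (\<Sum>x\<in>S. \<pi> x * (m + (1 - \<delta>) ^ s))"
        unfolding stat by (intro sum_mono mult_left_mono m stat_nonneg)
      also have "\<dots> = m + (1 - \<delta>) ^ s" using stat_sum by (simp flip: sum_distrib_right)
      finally show ?thesis .
    qed
    ultimately show "\<bar>(\<Sum>y\<in>A. transition_power S P (2 * s) x y) - (\<Sum>y\<in>A. \<pi> y)\<bar> \<le> (1 - \<delta>) ^ s"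
      using m[OF x] unfolding start by linarith
  qed
  then show ?thesis
    unfolding mixing_dist_def using finite nonempty by simp
qed

end

section \<open>The commuting chain of a finite group\<close>

context group
begin

section \<open>Conjugacy classes and centralizers\<close>

lemma conj_class_eq_orbit:
  assumes "x \<in> carrier G"
  shows "conj_class G x = orbit G (\<lambda>g. \<lambda>h \<in> carrier G. g \<otimes> h \<otimes> inv g) x"
  using assms by (auto simp: conj_class_def orbit_def)

lemma centralizer_eq_stabilizer:
  assumes x: "x \<in> carrier G"
  shows "centralizer_of G x = stabilizer G (\<lambda>g. \<lambda>h \<in> carrier G. g \<otimes> h \<otimes> inv g) x"
proof -
  have "g \<otimes> x = x \<otimes> g \<longleftrightarrow> g \<otimes> x \<otimes> inv g = x" if "g \<in> carrier G" for g
    using x that by (metis inv_solve_right' m_closed)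
  then show ?thesis
    using x by (auto simp: centralizer_of_def stabilizer_def)
qed

lemma card_conj_class_centralizer:
  assumes "x \<in> carrier G"
  shows "card (conj_class G x) * card (centralizer_of G x) = order G"
  using group_action.orbit_stabilizer_theorem[OF action_by_conjugation assms]
  by (simp add: conj_class_eq_orbit centralizer_eq_stabilizer assms)

lemma conj_class_eq_iff:
  assumes "x \<in> carrier G" "y \<in> carrier G"
  shows "conj_class G x = conj_class G y \<longleftrightarrow> x \<in> conj_class G y"
proof -
  interpret group_action G "carrier G" "\<lambda>g. \<lambda>h \<in> carrier G. g \<otimes> h \<otimes> inv g"
    by (rule action_by_conjugation)
  let ?orb = "orbit G (\<lambda>g. \<lambda>h \<in> carrier G. g \<otimes> h \<otimes> inv g)"
  have "?orb x = ?orb y \<longleftrightarrow> x \<in> ?orb y"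
    using disjoint_union[of "?orb x" "?orb y"] orbit_refl assms by (auto simp: orbits_def)
  then show ?thesis using assms by (simp add: conj_class_eq_orbit)
qed

lemma conj_class_subset: "x \<in> carrier G \<Longrightarrow> conj_class G x \<subseteq> carrier G"
  by (auto simp: conj_class_def)

lemma centralizer_subset: "centralizer_of G x \<subseteq> carrier G"
  by (auto simp: centralizer_of_def)

lemma centralizer_self: "x \<in> carrier G \<Longrightarrow> x \<in> centralizer_of G x"
  by (auto simp: centralizer_of_def)

lemma centralizer_one: "centralizer_of G \<one> = carrier G"
  by (auto simp: centralizer_of_def)

lemma card_centralizer_pos:
  assumes "finite (carrier G)" "x \<in> carrier G"
  shows "0 < card (centralizer_of G x)"
  using assms finite_subset[OF centralizer_subset] centralizer_self by (auto simp: card_gt_0_iff)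

lemma card_conj_class_pos:
  assumes "finite (carrier G)" "x \<in> carrier G"
  shows "0 < card (conj_class G x)"
  using card_conj_class_centralizer[OF assms(2)] assms by (metis mult_0 order_gt_0_iff_finite gr0I)

lemma num_conj_classes_pos:
  assumes "finite (carrier G)"
  shows "0 < num_conj_classes G"
  using assms by (auto simp: num_conj_classes_def card_gt_0_iff)

text \<open>Orbit-stabilizer turns the reciprocal class size into a multiple of the centralizer
  size, which cancels against the factor in \<open>commuting_matrix\<close>.\<close>

lemma commuting_stationary_eq:
  assumes "finite (carrier G)" "x \<in> carrier G"
  shows "commuting_stationary G x
    = real (card (centralizer_of G x)) / (real (num_conj_classes G) * real (order G))"
  using card_centralizer_pos[OF assms] unfolding card_conj_class_centralizer[OF assms(2), symmetric]
  by (simp add: commuting_stationary_def)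

text \<open>Grouped by conjugacy class, the reciprocals of the class sizes add up to 1 on each
  class.\<close>

lemma sum_commuting_stationary:
  assumes fin: "finite (carrier G)"
  shows "(\<Sum>x\<in>carrier G. commuting_stationary G x) = 1"
proof -
  have "(\<Sum>x\<in>carrier G. 1 / real (card (conj_class G x)))
      = (\<Sum>K\<in>conj_class G ` carrier G. \<Sum>x | x \<in> carrier G \<and> conj_class G x = K. 1 / real (card K))"
    using fin by (subst sum.image_gen[OF fin, of _ "conj_class G"]) (auto intro!: sum.cong)
  also have "\<dots> = (\<Sum>K\<in>conj_class G ` carrier G. 1)"
  proof (intro sum.cong refl)
    fix K assume "K \<in> conj_class G ` carrier G"
    then obtain y where y: "y \<in> carrier G" "K = conj_class G y" by auto
    have "{x \<in> carrier G. conj_class G x = K} = K"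
      using conj_class_eq_iff y conj_class_subset[OF y(1)] by auto
    then show "(\<Sum>x | x \<in> carrier G \<and> conj_class G x = K. 1 / real (card K)) = 1"
      using card_conj_class_pos[OF fin y(1)] y by simp
  qed
  also have "\<dots> = real (num_conj_classes G)" by (simp add: num_conj_classes_def)
  finally show ?thesis
    using num_conj_classes_pos[OF fin]
    by (simp add: commuting_stationary_def flip: sum_divide_distrib divide_divide_eq_left'
        divide_divide_eq_left)
qed

section \<open>The commuting chain and estimates for its distance from stationarity\<close>

lemma sum_commuting_matrix:
  assumes "finite (carrier G)" "x \<in> carrier G" "A \<subseteq> carrier G"
  shows "(\<Sum>y\<in>A. commuting_matrix G x y)
    = real (card (A \<inter> centralizer_of G x)) / real (card (centralizer_of G x))"
proof -
  have "(\<Sum>y\<in>A. commuting_matrix G x y)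
      = (\<Sum>y\<in>A \<inter> centralizer_of G x. 1 / real (card (centralizer_of G x)))"
    using assms finite_subset[OF assms(3,1)]
    by (subst sum.inter_restrict)
      (auto simp: commuting_matrix_def centralizer_of_def dest: sym intro!: sum.cong)
  then show ?thesis by simp
qed

lemma commuting_chain:
  assumes fin: "finite (carrier G)"
  shows "finite_chain (carrier G) (commuting_matrix G) (commuting_stationary G)"
proof
  show "finite (carrier G)" by fact
  show "0 \<le> commuting_matrix G x y" for x y by (simp add: commuting_matrix_def)
  show row: "(\<Sum>y\<in>carrier G. commuting_matrix G x y) = 1" if "x \<in> carrier G" for x
    using sum_commuting_matrix[OF fin that subset_refl] card_centralizer_pos[OF fin that]
    by (simp add: Int_absorb1 centralizer_subset)
  show "0 \<le> commuting_stationary G x" for x by (simp add: commuting_stationary_def)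
  show "(\<Sum>x\<in>carrier G. commuting_stationary G x) = 1" by (rule sum_commuting_stationary[OF fin])
  show "(\<Sum>x\<in>carrier G. commuting_stationary G x * commuting_matrix G x y) = commuting_stationary G y"
    if y: "y \<in> carrier G" for y
  proof -
    \<comment> \<open>Detailed balance: for commuting \<open>x\<close> and \<open>y\<close> both
      sides are the reciprocal of the number of classes times the group order, otherwise both are 0.
      Stationarity follows by summing a row.\<close>
    have "commuting_stationary G x * commuting_matrix G x y
        = commuting_stationary G y * commuting_matrix G y x" if x: "x \<in> carrier G" for x
      using card_centralizer_pos[OF fin x] card_centralizer_pos[OF fin y]
      by (auto simp: commuting_stationary_eq[OF fin] x y commuting_matrix_def)
    then show ?thesis using row[OF y] by (simp flip: sum_distrib_left)
  qed
qed

text \<open>A single intermediate state suffices: one of the two steps leaves \<open>\<one>\<close>,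
  with probability \<open>1 / order G\<close> for each target, and the other leaves a nontrivial
  element, with probability at least \<open>1 / N\<close> for a commuting target.\<close>

lemma commuting_two_step_ge:
  assumes fin: "finite (carrier G)" and a: "a \<in> carrier G" "a \<noteq> \<one>"
    and N: "\<And>x. x \<in> carrier G \<Longrightarrow> x \<noteq> \<one> \<Longrightarrow> card (centralizer_of G x) \<le> N"
    and x: "x \<in> carrier G" and y: "y \<in> carrier G"
  shows "1 / real N * (1 / real (order G))
    \<le> (\<Sum>z\<in>carrier G. commuting_matrix G x z * commuting_matrix G z y)"
proof -
  note pos = card_centralizer_pos[OF fin]
  have step: ?thesis if z: "z \<in> carrier G" and
    le: "1 / real N * (1 / real (order G)) \<le> commuting_matrix G x z * commuting_matrix G z y" for z
  proof -
    have "commuting_matrix G x z * commuting_matrix G z y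
        \<le> (\<Sum>z\<in>carrier G. commuting_matrix G x z * commuting_matrix G z y)"
      using fin z by (intro member_le_sum) (auto simp: commuting_matrix_def)
    with le show ?thesis by linarith
  qed
  have inv_le: "1 / real N \<le> 1 / real (card (centralizer_of G z))"
    if "z \<in> carrier G" "z \<noteq> \<one>" for z
    using N[OF that] pos[OF that(1)] by (intro divide_left_mono) auto
  have row_one: "commuting_matrix G \<one> z = 1 / real (order G)" if "z \<in> carrier G" for z
    using that by (simp add: commuting_matrix_def centralizer_one order_def)
  \<comment> \<open>The intermediate state is \<open>\<one>\<close>, \<open>y\<close> and
    \<open>a\<close> respectively. In the last case both ends are trivial, and the nontrivial
    \<open>a\<close> serves as a detour.\<close>
  consider "x \<noteq> \<one>" | "x = \<one>" "y \<noteq> \<one>" | "x = \<one>" "y = \<one>" by auto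
  then show ?thesis
  proof cases
    case 1
    have "1 / real N \<le> commuting_matrix G x \<one>"
      using inv_le[OF x 1] x by (simp add: commuting_matrix_def)
    then show ?thesis using row_one[OF y]
      by (intro step[OF one_closed] mult_mono) (auto simp: commuting_matrix_def)
  next
    case 2
    have "1 / real N \<le> commuting_matrix G y y"
      using inv_le[OF y 2(2)] by (simp add: commuting_matrix_def)
    from mult_left_mono[OF this, of "1 / real (order G)"] show ?thesis
      using row_one[OF y] 2 by (intro step[OF y]) (simp add: mult.commute)
  next
    case 3
    have "1 / real N \<le> commuting_matrix G a \<one>"
      using inv_le[OF a] a by (simp add: commuting_matrix_def)
    from mult_left_mono[OF this, of "1 / real (order G)"] show ?thesis
      using row_one[OF a(1)] 3 by (intro step[OF a(1)]) (simp add: mult.commute)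
  qed
qed

text \<open>Minorization with \<open>\<delta> = 1 / N\<close> and the uniform distribution as
  \<open>\<nu>\<close>.\<close>

lemma commuting_mixing_dist_le:
  assumes fin: "finite (carrier G)" and a: "a \<in> carrier G" "a \<noteq> \<one>"
    and N: "\<And>x. x \<in> carrier G \<Longrightarrow> x \<noteq> \<one> \<Longrightarrow> card (centralizer_of G x) \<le> N"
  shows "mixing_dist (carrier G) (commuting_matrix G) (commuting_stationary G) (2 * s)
    \<le> (1 - 1 / real N) ^ s"
proof -
  interpret finite_chain "carrier G" "commuting_matrix G" "commuting_stationary G"
    by (rule commuting_chain[OF fin])
  have "1 \<le> N"
    using N[OF a] card_centralizer_pos[OF fin a(1)] by linarith
  show ?thesis
  proof (rule mixing_dist_le_minorization)
    show "(\<Sum>y\<in>carrier G. 1 / real (order G)) = 1"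
      using fin by (auto simp: order_def)
  qed (use \<open>1 \<le> N\<close> commuting_two_step_ge[OF fin a N] in auto)
qed

text \<open>The distinguishing event is the centralizer of \<open>x\<close> without
  \<open>\<one>\<close>. From each of its elements the next state is uniform on the same
  \<open>m\<close> elements, so only the move to \<open>\<one>\<close> leaves the event, with
  probability \<open>1 / m\<close>.\<close>

lemma commuting_mixing_dist_ge:
  assumes fin: "finite (carrier G)" and x: "x \<in> carrier G" "x \<noteq> \<one>"
    and CA: "\<And>y. y \<in> centralizer_of G x - {\<one>} \<Longrightarrow> centralizer_of G y = centralizer_of G x"
    and m: "card (centralizer_of G x) = m"
  shows "(1 - 1 / real m) ^ t - real m ^ 2 / real (order G)
    \<le> mixing_dist (carrier G) (commuting_matrix G) (commuting_stationary G) t"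
proof -
  interpret finite_chain "carrier G" "commuting_matrix G" "commuting_stationary G"
    by (rule commuting_chain[OF fin])
  define B where "B = centralizer_of G x - {\<one>}"
  have B: "B \<subseteq> carrier G" "x \<in> B"
    using centralizer_subset centralizer_self x by (auto simp: B_def)
  have m0: "0 < m" using card_centralizer_pos[OF fin x(1)] m by simp
  have "\<one> \<in> centralizer_of G x" using x by (simp add: centralizer_of_def)
  then have cardB: "card B = m - 1" using m by (simp add: B_def card_Diff_singleton)
  have stay: "1 - 1 / real m \<le> (\<Sum>z\<in>B. commuting_matrix G y z)" if y: "y \<in> B" for y
  proof -
    have "centralizer_of G y = centralizer_of G x" using CA y by (simp add: B_def)
    moreover have "B \<inter> centralizer_of G x = B" by (auto simp: B_def)
    ultimately show ?thesis
      using sum_commuting_matrix[OF fin _ B(1), of y] y B m cardB m0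
      by (auto simp: field_simps of_nat_diff)
  qed
  have \<pi>B: "(\<Sum>y\<in>B. commuting_stationary G y) \<le> real m ^ 2 / real (order G)"
  proof -
    \<comment> \<open>Bounding the number of classes below by 1 is crude, but it is enough once the
      group order is of size \<open>m ^ 3\<close>.\<close>
    have "commuting_stationary G y \<le> real m / real (order G)" if y: "y \<in> B" for y
    proof -
      have "1 * real (order G) \<le> real (num_conj_classes G) * real (order G)"
        using num_conj_classes_pos[OF fin] by (intro mult_right_mono) auto
      then show ?thesis
        unfolding commuting_stationary_eq[OF fin subsetD[OF B(1) y]] CA[OF y[unfolded B_def]] m
        using fin order_gt_0_iff_finite num_conj_classes_pos[OF fin]
        by (intro divide_left_mono) auto
    qed
    then have "(\<Sum>y\<in>B. commuting_stationary G y) \<le> real (card B) * (real m / real (order G))"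
      by (intro sum_bounded_above) auto
    also have "\<dots> \<le> real m * (real m / real (order G))"
      using cardB by (intro mult_right_mono) auto
    finally show ?thesis by (simp add: power2_eq_square)
  qed
  have "(1 - 1 / real m) ^ t \<le> (\<Sum>y\<in>B. transition_power (carrier G) (commuting_matrix G) t x y)"
    using m0 by (intro transition_power_stay B stay) auto
  then show ?thesis
    using mixing_dist_ge[OF x(1) B(1), of t] \<pi>B by linarith
qed

end

lemma iso_centralizer:
  assumes "group G" "group H" and h: "h \<in> iso G H" and x: "x \<in> carrier G"
  shows "centralizer_of H (h x) = h ` centralizer_of G x"
proof -
  have hom: "\<And>a b. a \<in> carrier G \<Longrightarrow> b \<in> carrier G \<Longrightarrow> h (a \<otimes>\<^bsub>G\<^esub> b) = h a \<otimes>\<^bsub>H\<^esub> h b"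
    and inj: "inj_on h (carrier G)" and img: "h ` carrier G = carrier H"
    using h by (auto simp: iso_def hom_def bij_betw_def)
  have "h a \<otimes>\<^bsub>H\<^esub> h x = h x \<otimes>\<^bsub>H\<^esub> h a \<longleftrightarrow> a \<otimes>\<^bsub>G\<^esub> x = x \<otimes>\<^bsub>G\<^esub> a" if "a \<in> carrier G" for a
    using that x assms(1) inj by (simp add: inj_on_eq_iff group.is_monoid monoid.m_closed flip: hom)
  then show ?thesis
    by (auto simp: centralizer_of_def simp flip: img)
qed

section \<open>Groups with small centralizers\<close>

lemma mixing_time_le: "mixing_dist S P \<pi> t \<le> \<epsilon> \<Longrightarrow> mixing_time S P \<pi> \<epsilon> \<le> t"
  unfolding mixing_time_def by (rule Least_le)

text \<open>The first assumption guarantees that some time qualifies, so that the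
  \<open>LEAST\<close> in \<open>mixing_time\<close> is attained and satisfies its defining
  inequality.\<close>

lemma mixing_time_ge:
  assumes "mixing_dist S P \<pi> s \<le> \<epsilon>"
    and "\<And>t. real t < c \<Longrightarrow> \<epsilon> < mixing_dist S P \<pi> t"
  shows "c \<le> real (mixing_time S P \<pi> \<epsilon>)"
proof -
  have "mixing_dist S P \<pi> (mixing_time S P \<pi> \<epsilon>) \<le> \<epsilon>"
    unfolding mixing_time_def by (rule LeastI) (rule assms(1))
  then show ?thesis using assms(2)[of "mixing_time S P \<pi> \<epsilon>"] by (meson not_less)
qed

text \<open>The interface between group theory and the chain estimates. Its conditions are invariant
  under isomorphism, so they can be checked on matrices and carried to the quotient. The element
  \<open>a\<close> stands for a nontrivial unipotent matrix.\<close>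

locale thin_centralizer_group = group G for G (structure) and q :: nat and a +
  assumes q_ge: "4 \<le> q"
    and finite: "finite (carrier G)"
    and order_ge: "(q - 1) * q\<^sup>2 \<le> order G"
    and card_centralizer_le: "\<And>x. x \<in> carrier G \<Longrightarrow> x \<noteq> \<one> \<Longrightarrow> card (centralizer_of G x) \<le> q + 1"
    and a: "a \<in> carrier G" "a \<noteq> \<one>"
    and card_centralizer: "card (centralizer_of G a) = q"
    and centralizer_eq: "\<And>y. y \<in> centralizer_of G a - {\<one>} \<Longrightarrow> centralizer_of G y = centralizer_of G a"
begin

abbreviation distance :: "nat \<Rightarrow> real" where
  "distance \<equiv> mixing_dist (carrier G) (commuting_matrix G) (commuting_stationary G)"

lemma distance_le: "distance (2 * s) \<le> (1 - 1 / (real q + 1)) ^ s"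
  using commuting_mixing_dist_le[OF finite a card_centralizer_le, of s] by (simp add: add.commute)

text \<open>Bernoulli's inequality makes the staying probability linear in \<open>t\<close>, and the
  bound on the order turns the stationary mass into \<open>1 / (q - 1)\<close>.\<close>

lemma distance_ge: "1 - real t / real q - 1 / (real q - 1) \<le> distance t"
proof -
  have "1 + real t * (- (1 / real q)) \<le> (1 + (- (1 / real q))) ^ t"
    using q_ge by (intro Bernoulli_inequality) auto
  then have 1: "1 - real t / real q \<le> (1 - 1 / real q) ^ t" by simp
  have "real ((q - 1) * q\<^sup>2) \<le> real (order G)" using order_ge by (simp only: of_nat_le_iff)
  then have "(real q - 1) * (real q)\<^sup>2 \<le> real (order G)" using q_ge by (simp add: of_nat_diff)
  moreover have "0 < (real q - 1) * (real q)\<^sup>2" using q_ge by simp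
  ultimately have "(real q)\<^sup>2 / real (order G) \<le> (real q)\<^sup>2 / ((real q - 1) * (real q)\<^sup>2)"
    by (intro divide_left_mono) auto
  also have "\<dots> = 1 / (real q - 1)" using q_ge by simp
  finally show ?thesis
    using commuting_mixing_dist_ge[OF finite a centralizer_eq card_centralizer, of t] 1 by linarith
qed

lemma distance_le_quarter:
  assumes "s = nat \<lceil>(real q + 1) * ln 4\<rceil>"
  shows "distance (2 * s) \<le> 1 / 4"
proof -
  have s: "(real q + 1) * ln 4 \<le> real s" using assms by (metis real_nat_ceiling_ge)
  have "1 - 1 / (real q + 1) \<le> exp (- (1 / (real q + 1)))"
    using exp_ge_add_one_self[of "- (1 / (real q + 1))"] by simp
  then have "(1 - 1 / (real q + 1)) ^ s \<le> exp (- (1 / (real q + 1))) ^ s"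
    by (intro power_mono) auto
  also have "\<dots> = exp (- (real s / (real q + 1)))" by (simp flip: exp_of_nat_mult)
  also have "\<dots> \<le> exp (- ln 4)" using s by (simp add: field_simps)
  also have "\<dots> = 1 / 4" by (simp add: exp_minus)
  finally show ?thesis using distance_le[of s] by linarith
qed

text \<open>Here \<open>ln 16 = 2 * ln 4\<close> accounts for the two steps per contraction, and
  rounding \<open>s\<close> up costs less than 1, hence less than 2 in \<open>2 * s\<close>.\<close>

lemma mixing_time_quarter_le:
  "int (commuting_mixing_time G (1 / 4)) \<le> \<lceil>(real q + 1) * ln 16 + 2\<rceil>"
proof -
  define s where "s = nat \<lceil>(real q + 1) * ln 4\<rceil>"
  have "ln (16::real) = ln (4 ^ 2)" by simp
  then have ln16: "ln (16::real) = 2 * ln 4" by (subst (asm) ln_realpow) auto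
  have "real s < (real q + 1) * ln 4 + 1"
    unfolding s_def using ceiling_correct[of "(real q + 1) * ln 4"] by simp
  then have "real_of_int (int (2 * s)) \<le> (real q + 1) * ln 16 + 2" by (simp add: ln16)
  then have "int (2 * s) \<le> \<lceil>(real q + 1) * ln 16 + 2\<rceil>" by linarith
  moreover have "commuting_mixing_time G (1 / 4) \<le> 2 * s"
    unfolding commuting_mixing_time_def
    by (rule mixing_time_le[OF distance_le_quarter]) (rule s_def)
  ultimately show ?thesis by linarith
qed

lemma mixing_time_quarter_ge: "(real q + 1) / 4 \<le> real (commuting_mixing_time G (1 / 4))"
  unfolding commuting_mixing_time_def
proof (rule mixing_time_ge[OF distance_le_quarter[OF refl]])
  fix t assume t: "real t < (real q + 1) / 4"
  have "real t / real q \<le> ((real q + 1) / 4) / real q"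
    using t by (intro divide_right_mono) auto
  \<comment> \<open>At \<open>q = 4\<close> this is an equality. The two losses
    \<open>5 / 16\<close> and \<open>1 / 3\<close> add up to \<open>31 / 48\<close>, below the
    admissible \<open>3 / 4\<close>.\<close>
  also have "\<dots> \<le> 5 / 16" using q_ge by (simp add: field_simps)
  finally have "real t / real q \<le> 5 / 16" .
  moreover have "1 / (real q - 1) \<le> 1 / 3" using q_ge by simp
  ultimately show "1 / 4 < distance t" using distance_ge[of t] by linarith
qed

lemma distance_le_eventually: "0 < \<epsilon> \<Longrightarrow> \<exists>t. distance t \<le> \<epsilon>"
proof -
  assume "0 < \<epsilon>"
  then obtain s where "(1 - 1 / (real q + 1)) ^ s < \<epsilon>"
    using real_arch_pow_inv[of \<epsilon> "1 - 1 / (real q + 1)"] by auto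
  then have "distance (2 * s) \<le> \<epsilon>" using distance_le[of s] by linarith
  then show ?thesis ..
qed

text \<open>The upper bound at \<open>9 / 10\<close> is about \<open>2 * q / 9\<close>, the lower
  bound at \<open>1 / 10\<close> about \<open>9 * q / 10\<close>; from \<open>q = 16\<close> on the
  rounding terms no longer spoil the factor 2.\<close>

lemma mixing_time_ratio:
  assumes "16 \<le> q"
  shows "2 * real (commuting_mixing_time G (9 / 10)) \<le> real (commuting_mixing_time G (1 / 10))"
proof -
  \<comment> \<open>Chosen so that \<open>1 + s / q\<close> is at least \<open>10 / 9\<close>.
    Bernoulli is applied to the reciprocal \<open>1 + 1 / q\<close> of the contraction factor, since
    an upper bound on its power is wanted.\<close>
  define s where "s = q div 9 + 1"
  have s: "real q / 9 \<le> real s" "real s \<le> real q / 9 + 1"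
    unfolding s_def by linarith+
  have "1 / 9 \<le> real s * (1 / real q)" using s assms by (simp add: field_simps)
  then have "10 / 9 \<le> 1 + real s * (1 / real q)" by simp
  also have "\<dots> \<le> (1 + 1 / real q) ^ s" by (intro Bernoulli_inequality) (simp add: order.trans[of _ 0])
  finally have "inverse ((1 + 1 / real q) ^ s) \<le> inverse (10 / 9)" by (intro le_imp_inverse_le) auto
  moreover have "inverse (1 + 1 / real q) = 1 - 1 / (real q + 1)"
    using assms by (simp add: field_simps)
  ultimately have "(1 - 1 / (real q + 1)) ^ s \<le> 9 / 10" by (simp flip: power_inverse)
  then have "distance (2 * s) \<le> 9 / 10" using distance_le[of s] by linarith
  then have "commuting_mixing_time G (9 / 10) \<le> 2 * s"
    unfolding commuting_mixing_time_def by (rule mixing_time_le)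
  then have up: "real (commuting_mixing_time G (9 / 10)) \<le> 2 * real s"
    by (metis of_nat_le_iff of_nat_mult of_nat_numeral)
  obtain t0 where "distance t0 \<le> 1 / 10" using distance_le_eventually[of "1 / 10"] by auto
  then have "9 * real q / 10 - 2 \<le> real (commuting_mixing_time G (1 / 10))"
    unfolding commuting_mixing_time_def
  proof (rule mixing_time_ge)
    \<comment> \<open>The offset 2 yields a gain of \<open>2 / q\<close>, which outweighs the loss
      \<open>1 / (q - 1)\<close> in \<open>distance_ge\<close>.\<close>
    fix t assume "real t < 9 * real q / 10 - 2"
    then have "real t / real q \<le> (9 * real q / 10 - 2) / real q"
      by (intro divide_right_mono) auto
    also have "\<dots> = 9 / 10 - 2 / real q" using assms by (simp add: field_simps)
    finally have "real t / real q \<le> 9 / 10 - 2 / real q" .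
    moreover have "1 / (real q - 1) < 2 / real q" using assms by (simp add: field_simps)
    ultimately show "1 / 10 < distance t" using distance_ge[of t] by linarith
  qed
  then show ?thesis using up s assms by linarith
qed

end

section \<open>The special linear group in characteristic 2\<close>

lemma (in cring) mat2_det_mult:
  assumes "A \<in> carrier R \<times> carrier R \<times> carrier R \<times> carrier R"
    and "B \<in> carrier R \<times> carrier R \<times> carrier R \<times> carrier R"
  shows "mat2_det R (mat2_mult R A B) = mat2_det R A \<otimes> mat2_det R B"
  using assms by (cases A; cases B) (auto, algebra)

lemma (in cring) group_SL2: "group (SL2 R)"
proof (rule groupI)
  fix A B assume AB: "A \<in> carrier (SL2 R)" "B \<in> carrier (SL2 R)"
  then have "mat2_det R (mat2_mult R A B) = \<one>"
    by (subst mat2_det_mult) (auto simp: SL2_def)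
  with AB show "A \<otimes>\<^bsub>SL2 R\<^esub> B \<in> carrier (SL2 R)"
    by (cases A; cases B) (auto simp: SL2_def)
next
  fix A B C
  assume "A \<in> carrier (SL2 R)" "B \<in> carrier (SL2 R)" "C \<in> carrier (SL2 R)"
  then show "A \<otimes>\<^bsub>SL2 R\<^esub> B \<otimes>\<^bsub>SL2 R\<^esub> C = A \<otimes>\<^bsub>SL2 R\<^esub> (B \<otimes>\<^bsub>SL2 R\<^esub> C)"
    by (cases A; cases B; cases C) (auto simp: SL2_def l_distr r_distr m_assoc a_ac)
next
  fix A assume A: "A \<in> carrier (SL2 R)"
  obtain a b c d where abcd: "A = (a, b, c, d)" by (cases A) auto
  \<comment> \<open>The adjugate is the inverse of a matrix of determinant 1.\<close>
  have "(d, \<ominus> b, \<ominus> c, a) \<in> carrier (SL2 R)"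
    "(d, \<ominus> b, \<ominus> c, a) \<otimes>\<^bsub>SL2 R\<^esub> A = \<one>\<^bsub>SL2 R\<^esub>"
    using A by (auto simp: SL2_def abcd l_minus r_minus minus_eq m_comm a_comm l_neg r_neg)
  then show "\<exists>B\<in>carrier (SL2 R). B \<otimes>\<^bsub>SL2 R\<^esub> A = \<one>\<^bsub>SL2 R\<^esub>" by blast
qed (auto simp: SL2_def minus_eq)

lemma (in cring) finite_SL2: "finite (carrier R) \<Longrightarrow> finite (carrier (SL2 R))"
  by (rule finite_subset[of _ "carrier R \<times> carrier R \<times> carrier R \<times> carrier R"])
    (auto simp: SL2_def)

locale field_char_2 = field R for R (structure) +
  assumes one_add_one: "\<one> \<oplus> \<one> = \<zero>"
begin

lemma add_self: "x \<in> carrier R \<Longrightarrow> x \<oplus> x = \<zero>"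
  using one_add_one by (metis l_distr l_null l_one one_closed)

lemma add_self_left: "x \<in> carrier R \<Longrightarrow> y \<in> carrier R \<Longrightarrow> x \<oplus> (x \<oplus> y) = y"
  by (simp add: add_self flip: a_assoc)

lemma minus_eq_add: "x \<in> carrier R \<Longrightarrow> y \<in> carrier R \<Longrightarrow> x \<ominus> y = x \<oplus> y"
  by (metis add_self minus_equality minus_eq)

text \<open>A normalizer for polynomial identities in characteristic 2: expand, sort, and cancel
  equal neighbouring summands.\<close>

lemmas char_2_simps = add_self add_self_left l_distr r_distr a_ac m_ac

lemma add_eq_zero_iff: "x \<in> carrier R \<Longrightarrow> y \<in> carrier R \<Longrightarrow> x \<oplus> y = \<zero> \<longleftrightarrow> x = y"
  by (metis a_comm add_self add_self_left r_zero)

text \<open>In characteristic 2, \<open>x^2 + 1 = (x + 1)^2\<close>.\<close>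

lemma square_eq_one:
  assumes "x \<in> carrier R" "x \<otimes> x = \<one>"
  shows "x = \<one>"
proof -
  have "(x \<oplus> \<one>) \<otimes> (x \<oplus> \<one>) = \<zero>" using assms by (simp add: char_2_simps)
  then show ?thesis using assms by (simp add: integral_iff add_eq_zero_iff)
qed

lemma SL2_iff:
  "(a, b, c, d) \<in> carrier (SL2 R) \<longleftrightarrow>
     a \<in> carrier R \<and> b \<in> carrier R \<and> c \<in> carrier R \<and> d \<in> carrier R \<and> a \<otimes> d \<oplus> b \<otimes> c = \<one>"
  by (auto simp: SL2_def minus_eq_add)

text \<open>A scalar matrix has determinant \<open>a^2\<close>, and 1 has only one square
  root.\<close>

lemma scalar_SL2_eq: "scalar_SL2 R = {\<one>\<^bsub>SL2 R\<^esub>}"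
proof -
  have "(a, \<zero>, \<zero>, a) = (\<one>, \<zero>, \<zero>, \<one>)" if "(a, \<zero>, \<zero>, a) \<in> carrier (SL2 R)" for a
    using square_eq_one[of a] that by (auto simp: SL2_iff)
  then have "scalar_SL2 R \<subseteq> {(\<one>, \<zero>, \<zero>, \<one>)}" unfolding scalar_SL2_def by blast
  moreover have "{(\<one>, \<zero>, \<zero>, \<one>)} \<subseteq> scalar_SL2 R" by (auto simp: scalar_SL2_def SL2_iff)
  ultimately have "scalar_SL2 R = {(\<one>, \<zero>, \<zero>, \<one>)}" by (rule subset_antisym)
  then show ?thesis by (simp add: SL2_def)
qed

section \<open>Centralizers and order of SL(2) in characteristic 2\<close>

text \<open>For a matrix \<open>X\<close> of determinant 1 and trace \<open>T\<close>, the quadratic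
  form is the determinant of \<open>u + v X\<close>.\<close>

definition conic :: "'a \<Rightarrow> ('a \<times> 'a) set" where
  "conic T = {(u, v). u \<in> carrier R \<and> v \<in> carrier R \<and>
     u \<otimes> u \<oplus> T \<otimes> u \<otimes> v \<oplus> v \<otimes> v = \<one>}"

text \<open>The point \<open>(\<one>, \<zero>)\<close> lies on the conic; every other point is determined by the slope
  \<open>(u - \<one>) / v\<close> of the line joining them.\<close>

lemma card_conic:
  assumes fin: "finite (carrier R)" and T: "T \<in> carrier R"
  shows "card (conic T) \<le> card (carrier R) + 1" "finite (conic T)"
proof -
  \<comment> \<open>For \<open>T = \<zero>\<close> the equation is \<open>(u + v)^2 = 1\<close>, the
    line \<open>u + v = 1\<close>. Otherwise substitute \<open>u = 1 + s v\<close> and cancel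
    \<open>v\<close>, leaving \<open>v (s^2 + T s + 1) = T\<close>. Values of \<open>\<phi>\<close>
    at roots of the denominator do no harm, as only a covering of the conic is needed.\<close>
  define \<phi> where "\<phi> s = (if T = \<zero> then (\<one> \<oplus> s, s)
    else let v = T \<otimes> inv (s \<otimes> s \<oplus> T \<otimes> s \<oplus> \<one>) in (\<one> \<oplus> s \<otimes> v, v))" for s
  have sub: "conic T \<subseteq> insert (\<one>, \<zero>) (\<phi> ` carrier R)"
  proof
    fix p assume "p \<in> conic T"
    then obtain u v where p: "p = (u, v)" and uv: "u \<in> carrier R" "v \<in> carrier R"
      and eq: "u \<otimes> u \<oplus> T \<otimes> u \<otimes> v \<oplus> v \<otimes> v = \<one>" by (auto simp: conic_def)
    consider "v = \<zero>" | "v \<noteq> \<zero>" "T = \<zero>" | "v \<noteq> \<zero>" "T \<noteq> \<zero>" by auto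
    then show "p \<in> insert (\<one>, \<zero>) (\<phi> ` carrier R)"
    proof cases
      case 1
      then have "u \<otimes> u = \<one>" using eq uv T by simp
      then have "u = \<one>" by (rule square_eq_one[OF uv(1)])
      then show ?thesis using 1 p by simp
    next
      case 2
      then have "(u \<oplus> v) \<otimes> (u \<oplus> v) = \<one>" using eq uv by (simp add: char_2_simps)
      then have "u \<oplus> v = \<one>" by (rule square_eq_one[OF a_closed[OF uv]])
      moreover have "u \<oplus> v \<oplus> v = u" using uv by (simp add: a_assoc add_self)
      ultimately have "\<one> \<oplus> v = u" by simp
      then have "p = \<phi> v" using 2 p by (simp add: \<phi>_def)
      then show ?thesis using uv by blast
    next
      case 3
      then have v_unit: "v \<in> Units R" using uv by (simp add: field_Units)
      define s where "s = (u \<oplus> \<one>) \<otimes> inv v"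
      have s: "s \<in> carrier R" using uv v_unit by (simp add: s_def)
      have "s \<otimes> v = u \<oplus> \<one>" using uv v_unit by (simp add: s_def m_assoc)
      then have u: "u = \<one> \<oplus> s \<otimes> v" using uv by (simp add: char_2_simps)
      define D where "D = s \<otimes> s \<oplus> T \<otimes> s \<oplus> \<one>"
      have D: "D \<in> carrier R" using s T by (simp add: D_def)
      have "v \<otimes> (v \<otimes> D \<oplus> T) = u \<otimes> u \<oplus> T \<otimes> u \<otimes> v \<oplus> v \<otimes> v \<oplus> \<one>"
        unfolding u D_def using s uv T by (simp add: char_2_simps)
      also have "\<dots> = \<zero>" unfolding eq by (rule one_add_one)
      finally have vD: "v \<otimes> D = T"
        using 3 uv D T by (simp add: integral_iff add_eq_zero_iff)
      then have "D \<noteq> \<zero>" using 3 uv by auto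
      then have D_unit: "D \<in> Units R" using D by (simp add: field_Units)
      have "T \<otimes> inv D = v" unfolding vD[symmetric] using uv D D_unit by (simp add: m_assoc)
      then have "p = \<phi> s" using 3 p u by (simp add: \<phi>_def D_def)
      then show ?thesis using s by blast
    qed
  qed
  then show "finite (conic T)" using fin by (auto intro: finite_subset)
  have "card (conic T) \<le> card (insert (\<one>, \<zero>) (\<phi> ` carrier R))"
    using sub fin by (intro card_mono) auto
  also have "\<dots> \<le> Suc (card (\<phi> ` carrier R))" by (rule card_insert_le_m1) simp_all
  also have "\<dots> \<le> card (carrier R) + 1" using card_image_le[OF fin, of \<phi>] by simp
  finally show "card (conic T) \<le> card (carrier R) + 1" .
qed

text \<open>A matrix commuting with a nonscalar matrix \<open>X\<close> has the form
  \<open>u + v X\<close>. The commutation equations make \<open>(f, g, e + i)\<close> proportional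
  to \<open>(b, c, a + d)\<close>, and \<open>v\<close> is the ratio.\<close>

lemma centralizer_SL2D:
  assumes x: "(a, b, c, d) \<in> carrier (SL2 R)" "(a, b, c, d) \<noteq> \<one>\<^bsub>SL2 R\<^esub>"
    and h: "(e, f, g, i) \<in> centralizer_of (SL2 R) (a, b, c, d)"
  obtains u v where "u \<in> carrier R" "v \<in> carrier R"
    "(e, f, g, i) = (u \<oplus> v \<otimes> a, v \<otimes> b, v \<otimes> c, u \<oplus> v \<otimes> d)"
proof -
  note result = that
  have xc: "a \<in> carrier R" "b \<in> carrier R" "c \<in> carrier R" "d \<in> carrier R"
    using x by (auto simp: SL2_iff)
  have hc: "e \<in> carrier R" "f \<in> carrier R" "g \<in> carrier R" "i \<in> carrier R"
    using h by (auto simp: SL2_iff centralizer_of_def)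
  have comm: "e \<otimes> a \<oplus> f \<otimes> c = a \<otimes> e \<oplus> b \<otimes> g" "e \<otimes> b \<oplus> f \<otimes> d = a \<otimes> f \<oplus> b \<otimes> i"
    "g \<otimes> a \<oplus> i \<otimes> c = c \<otimes> e \<oplus> d \<otimes> g"
    using h by (auto simp: centralizer_of_def SL2_def)
  \<comment> \<open>This equation and the next two say that the minors of the two proportional
    triples vanish.\<close>
  have fc: "b \<otimes> g = f \<otimes> c"
    using comm(1) xc hc by (simp add: m_comm[of e a])
  have eb: "b \<otimes> i = b \<otimes> e \<oplus> f \<otimes> (a \<oplus> d)"
  proof -
    have "b \<otimes> i = a \<otimes> f \<oplus> (a \<otimes> f \<oplus> b \<otimes> i)" using xc hc by (simp add: add_self_left)
    then show ?thesis unfolding comm(2)[symmetric] using xc hc by (simp add: char_2_simps)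
  qed
  have ec: "c \<otimes> i = c \<otimes> e \<oplus> g \<otimes> (a \<oplus> d)"
  proof -
    have "c \<otimes> i = g \<otimes> a \<oplus> (g \<otimes> a \<oplus> i \<otimes> c)" using xc hc by (simp add: add_self_left m_comm)
    then show ?thesis unfolding comm(3) using xc hc by (simp add: char_2_simps)
  qed
  have main: thesis if v: "v \<in> carrier R" "f = v \<otimes> b" "g = v \<otimes> c" "i = e \<oplus> v \<otimes> (a \<oplus> d)" for v
    by (rule result[of "e \<oplus> v \<otimes> a" v]) (use v xc hc in \<open>simp_all add: char_2_simps\<close>)
  \<comment> \<open>The ratio is read off at a nonzero entry of \<open>(b, c, a + d)\<close>. If all
    three vanish, the matrix is scalar of determinant 1, hence the identity, which is
    excluded.\<close>
  consider "b \<noteq> \<zero>" | "c \<noteq> \<zero>" | "b = \<zero>" "c = \<zero>" "a \<oplus> d \<noteq> \<zero>" | "b = \<zero>" "c = \<zero>" "a = d"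
    using xc by (auto simp: add_eq_zero_iff)
  then show thesis
  proof cases
    case 1
    define v where "v = f \<otimes> inv b"
    have b: "b \<in> Units R" using 1 xc by (simp add: field_Units)
    have v: "v \<in> carrier R" using b hc by (simp add: v_def)
    have f: "f = v \<otimes> b" using b xc hc by (simp add: v_def m_assoc)
    have "b \<otimes> g = b \<otimes> (v \<otimes> c)" using fc v xc by (simp add: f m_ac)
    then have "g = v \<otimes> c" using 1 v xc hc by (simp add: m_lcancel)
    moreover have "b \<otimes> i = b \<otimes> (e \<oplus> v \<otimes> (a \<oplus> d))"
      unfolding eb using v xc hc by (simp add: f r_distr m_ac)
    then have "i = e \<oplus> v \<otimes> (a \<oplus> d)" using 1 v xc hc by (simp add: m_lcancel)
    ultimately show thesis using main v f by blast
  next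
    case 2
    define v where "v = g \<otimes> inv c"
    have c: "c \<in> Units R" using 2 xc by (simp add: field_Units)
    have v: "v \<in> carrier R" using c hc by (simp add: v_def)
    have g: "g = v \<otimes> c" using c xc hc by (simp add: v_def m_assoc)
    have "c \<otimes> f = c \<otimes> (v \<otimes> b)" using fc v xc hc by (simp add: g m_ac)
    then have "f = v \<otimes> b" using 2 v xc hc by (simp add: m_lcancel)
    moreover have "c \<otimes> i = c \<otimes> (e \<oplus> v \<otimes> (a \<oplus> d))"
      unfolding ec using v xc hc by (simp add: g r_distr m_ac)
    then have "i = e \<oplus> v \<otimes> (a \<oplus> d)" using 2 v xc hc by (simp add: m_lcancel)
    ultimately show thesis using main v g by blast
  next
    case 3
    define v where "v = (e \<oplus> i) \<otimes> inv (a \<oplus> d)"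
    have ad: "a \<oplus> d \<in> Units R" using 3 xc by (simp add: field_Units)
    have v: "v \<in> carrier R" using ad hc by (simp add: v_def)
    have "v \<otimes> (a \<oplus> d) = e \<oplus> i" using ad xc hc by (simp add: v_def m_assoc)
    then have "i = e \<oplus> v \<otimes> (a \<oplus> d)" using hc by (simp add: add_self_left)
    moreover have "f \<otimes> (a \<oplus> d) = \<zero>" "g \<otimes> (a \<oplus> d) = \<zero>"
      using eb[symmetric] ec[symmetric] xc hc by (simp_all add: 3(1,2))
    then have "f = \<zero>" "g = \<zero>" using 3 xc hc by (simp_all add: integral_iff)
    ultimately show thesis using main v 3 by simp
  next
    case 4
    then have "d \<otimes> d = \<one>" using x(1) xc by (simp add: SL2_iff)
    then have "d = \<one>" by (rule square_eq_one[OF xc(4)])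
    then show thesis using 4 x(2) by (simp add: SL2_def)
  qed
qed

lemma card_centralizer_SL2:
  assumes fin: "finite (carrier R)" and x: "x \<in> carrier (SL2 R)" "x \<noteq> \<one>\<^bsub>SL2 R\<^esub>"
  shows "card (centralizer_of (SL2 R) x) \<le> card (carrier R) + 1"
proof -
  obtain a b c d where abcd: "x = (a, b, c, d)" by (cases x) auto
  have xc: "a \<in> carrier R" "b \<in> carrier R" "c \<in> carrier R" "d \<in> carrier R"
    and det: "a \<otimes> d \<oplus> b \<otimes> c = \<one>"
    using x by (auto simp: SL2_iff abcd)
  define \<psi> where "\<psi> = (\<lambda>(u, v). (u \<oplus> v \<otimes> a, v \<otimes> b, v \<otimes> c, u \<oplus> v \<otimes> d))"
  have "centralizer_of (SL2 R) x \<subseteq> \<psi> ` conic (a \<oplus> d)"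
  proof
    fix h assume h: "h \<in> centralizer_of (SL2 R) x"
    obtain e f g i where efgi: "h = (e, f, g, i)" by (cases h) auto
    obtain u v where uv: "u \<in> carrier R" "v \<in> carrier R"
      "(e, f, g, i) = (u \<oplus> v \<otimes> a, v \<otimes> b, v \<otimes> c, u \<oplus> v \<otimes> d)"
      by (rule centralizer_SL2D[OF x[unfolded abcd] h[unfolded abcd efgi]])
    \<comment> \<open>Writing the coefficient 1 of \<open>v^2\<close> as the determinant of
      \<open>x\<close> exposes the form as the determinant of \<open>h\<close>.\<close>
    have "u \<otimes> u \<oplus> (a \<oplus> d) \<otimes> u \<otimes> v \<oplus> v \<otimes> v
        = u \<otimes> u \<oplus> (a \<oplus> d) \<otimes> u \<otimes> v \<oplus> v \<otimes> v \<otimes> (a \<otimes> d \<oplus> b \<otimes> c)"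
      using uv by (simp add: det)
    also have "\<dots> = (u \<oplus> v \<otimes> a) \<otimes> (u \<oplus> v \<otimes> d) \<oplus> (v \<otimes> b) \<otimes> (v \<otimes> c)"
      using uv(1,2) xc by (simp add: char_2_simps)
    also have "\<dots> = \<one>" using h uv(3) by (simp add: efgi centralizer_of_def SL2_iff)
    finally have "(u, v) \<in> conic (a \<oplus> d)" using uv by (simp add: conic_def)
    then show "h \<in> \<psi> ` conic (a \<oplus> d)"
      using uv(3) by (intro image_eqI[of _ _ "(u, v)"]) (auto simp: \<psi>_def efgi)
  qed
  then have "card (centralizer_of (SL2 R) x) \<le> card (\<psi> ` conic (a \<oplus> d))"
    using card_conic[OF fin, of "a \<oplus> d"] xc by (intro card_mono) auto
  also have "\<dots> \<le> card (conic (a \<oplus> d))" using card_conic[OF fin, of "a \<oplus> d"] xc by (intro card_image_le) auto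
  also have "\<dots> \<le> card (carrier R) + 1" using card_conic[OF fin, of "a \<oplus> d"] xc by auto
  finally show ?thesis .
qed

text \<open>The right-hand side does not depend on \<open>f\<close>. Hence all nontrivial elements
  of this centralizer share it, which is the condition \<open>centralizer_eq\<close>.\<close>

lemma centralizer_unipotent:
  assumes f: "f \<in> carrier R" "f \<noteq> \<zero>"
  shows "centralizer_of (SL2 R) (\<one>, f, \<zero>, \<one>) = (\<lambda>y. (\<one>, y, \<zero>, \<one>)) ` carrier R"
proof (intro equalityI subsetI)
  fix h assume h: "h \<in> centralizer_of (SL2 R) (\<one>, f, \<zero>, \<one>)"
  obtain e y g i where eygi: "h = (e, y, g, i)" by (cases h) auto
  have hc: "e \<in> carrier R" "y \<in> carrier R" "g \<in> carrier R" "i \<in> carrier R"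
    and det: "e \<otimes> i \<oplus> y \<otimes> g = \<one>"
    using h by (auto simp: SL2_iff eygi centralizer_of_def)
  have comm: "e = e \<oplus> f \<otimes> g" "e \<otimes> f \<oplus> y = y \<oplus> f \<otimes> i"
    using h hc f by (auto simp: SL2_def eygi centralizer_of_def)
  have "f \<otimes> g = e \<oplus> (e \<oplus> f \<otimes> g)" using hc f by (simp add: add_self_left)
  also have "\<dots> = \<zero>" unfolding comm(1)[symmetric] by (rule add_self[OF hc(1)])
  finally have "f \<otimes> g = \<zero>" .
  then have g: "g = \<zero>" using hc f by (simp add: integral_iff)
  have "f \<otimes> e = f \<otimes> i" using comm(2) hc f by (simp add: a_comm m_comm)
  then have "e = i" using hc f by (simp add: m_lcancel)
  then have "e = \<one>" "i = \<one>" using det g hc square_eq_one[OF hc(1)] by auto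
  then show "h \<in> (\<lambda>y. (\<one>, y, \<zero>, \<one>)) ` carrier R" using g hc eygi by auto
next
  fix h assume "h \<in> (\<lambda>y. (\<one>, y, \<zero>, \<one>)) ` carrier R"
  then show "h \<in> centralizer_of (SL2 R) (\<one>, f, \<zero>, \<one>)"
    using f by (auto simp: centralizer_of_def SL2_iff) (auto simp: SL2_def a_comm)
qed

text \<open>Counts only the matrices with nonzero upper left entry, where the determinant condition
  determines the last entry.\<close>

lemma order_SL2_ge:
  assumes fin: "finite (carrier R)"
  shows "(card (carrier R) - 1) * (card (carrier R))\<^sup>2 \<le> order (SL2 R)"
proof -
  let ?A = "(carrier R - {\<zero>}) \<times> carrier R \<times> carrier R"
  let ?f = "\<lambda>(a, b, c). (a, b, c, inv a \<otimes> (\<one> \<oplus> b \<otimes> c))"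
  have "?f ` ?A \<subseteq> carrier (SL2 R)"
  proof (rule image_subsetI)
    fix p assume "p \<in> ?A"
    then obtain a b c where p: "p = (a, b, c)"
      and abc: "a \<in> carrier R" "b \<in> carrier R" "c \<in> carrier R" "a \<noteq> \<zero>" by auto
    then have "a \<in> Units R" by (simp add: field_Units)
    then have "a \<otimes> (inv a \<otimes> (\<one> \<oplus> b \<otimes> c)) = \<one> \<oplus> b \<otimes> c"
      using abc by (simp flip: m_assoc)
    then show "?f p \<in> carrier (SL2 R)"
      using abc \<open>a \<in> Units R\<close> by (simp add: p SL2_iff a_assoc add_self)
  qed
  moreover have "inj_on ?f ?A" by (auto simp: inj_on_def)
  ultimately have "card ?A \<le> card (carrier (SL2 R))"
    by (intro card_inj_on_le[OF _ _ finite_SL2[OF fin]])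
  then show ?thesis
    using fin by (simp add: order_def card_cartesian_product power2_eq_square card_Diff_singleton)
qed

end

section \<open>Fields of order \<open>2 ^ k\<close> and the passage from SL(2) to PSL(2)\<close>

text \<open>In the additive group the order of the group annihilates \<open>\<one>\<close>, so
  \<open>(1 + 1)^k = 0\<close>, and a field has no nilpotent elements other than zero.\<close>

lemma (in field) char_2_of_order:
  assumes "order R = 2 ^ k"
  shows "field_char_2 R"
proof
  have pow: "[(2 ^ n :: nat)] \<cdot> \<one> = (\<one> \<oplus> \<one>) [^] n" for n :: nat
  proof (induction n)
    case (Suc n)
    have "[(2 ^ Suc n :: nat)] \<cdot> \<one> = [(2 ^ n :: nat)] \<cdot> \<one> \<oplus> [(2 ^ n :: nat)] \<cdot> \<one>"
      by (simp add: mult_2 add.nat_pow_mult)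
    also have "\<dots> = ([(2 ^ n :: nat)] \<cdot> \<one>) \<otimes> (\<one> \<oplus> \<one>)" by (simp add: r_distr)
    finally show ?case by (simp add: Suc)
  qed simp
  have "\<one> [^]\<^bsub>add_monoid R\<^esub> order (add_monoid R) = \<one>\<^bsub>add_monoid R\<^esub>"
    by (rule group.pow_order_eq_1[OF a_group]) simp
  then have "[(2 ^ k :: nat)] \<cdot> \<one> = \<zero>"
    using assms by (simp add: add_pow_def order_def)
  then have "(\<one> \<oplus> \<one>) [^] k = \<zero>" by (simp add: pow)
  then show "\<one> \<oplus> \<one> = \<zero>" by (induction k) (auto simp: integral_iff)
qed

lemma thin_centralizer_group_iso:
  assumes "thin_centralizer_group G q a" "group H" and h: "h \<in> iso G H"
  shows "thin_centralizer_group H q (h a)"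
proof -
  interpret G: thin_centralizer_group G q a by fact
  interpret H: group H by fact
  have inj: "inj_on h (carrier G)" and img: "h ` carrier G = carrier H"
    using h by (auto simp: iso_def bij_betw_def)
  have one: "h \<one>\<^bsub>G\<^esub> = \<one>\<^bsub>H\<^esub>"
    using h G.is_group by (intro hom_one) (auto simp: iso_def)
  have eq_one_iff: "h x = \<one>\<^bsub>H\<^esub> \<longleftrightarrow> x = \<one>\<^bsub>G\<^esub>" if "x \<in> carrier G" for x
    using inj_on_eq_iff[OF inj that G.one_closed] one by simp
  note centralizer = iso_centralizer[OF G.is_group H.is_group h]
  have card: "card (centralizer_of H (h x)) = card (centralizer_of G x)" if "x \<in> carrier G" for x
    unfolding centralizer[OF that]
    by (rule card_image[OF inj_on_subset[OF inj G.centralizer_subset]])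
  show ?thesis
  proof
    show "4 \<le> q" by (rule G.q_ge)
    show "finite (carrier H)" using G.finite by (simp flip: img)
    have "order H = order G" unfolding order_def img[symmetric] by (rule card_image[OF inj])
    then show "(q - 1) * q\<^sup>2 \<le> order H" using G.order_ge by simp
    show "card (centralizer_of H y) \<le> q + 1" if "y \<in> carrier H" "y \<noteq> \<one>\<^bsub>H\<^esub>" for y
      using that G.card_centralizer_le by (auto simp: card eq_one_iff simp flip: img)
    show "h a \<in> carrier H" "h a \<noteq> \<one>\<^bsub>H\<^esub>" using G.a by (auto simp: eq_one_iff simp flip: img)
    show "card (centralizer_of H (h a)) = q" using G.a G.card_centralizer by (simp add: card)
    fix y assume "y \<in> centralizer_of H (h a) - {\<one>\<^bsub>H\<^esub>}"
    then obtain x where x: "x \<in> centralizer_of G a" "y = h x" "x \<noteq> \<one>\<^bsub>G\<^esub>"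
      using G.a one by (auto simp: centralizer)
    then have "x \<in> carrier G" using G.centralizer_subset by auto
    then show "centralizer_of H y = centralizer_of H (h a)"
      using x G.a G.centralizer_eq[of x] by (simp add: centralizer)
  qed
qed

lemma (in field_char_2) thin_SL2:
  assumes "4 \<le> order R"
  shows "thin_centralizer_group (SL2 R) (order R) (\<one>, \<one>, \<zero>, \<one>)"
proof -
  interpret S: group "SL2 R" by (rule group_SL2)
  have fin: "finite (carrier R)" using assms by (intro card_ge_0_finite) (simp add: order_def)
  have unip: "centralizer_of (SL2 R) (\<one>, \<one>, \<zero>, \<one>) = (\<lambda>y. (\<one>, y, \<zero>, \<one>)) ` carrier R"
    by (rule centralizer_unipotent) simp_all
  show ?thesis
  proof
    show "4 \<le> order R" by fact
    show "finite (carrier (SL2 R))" by (rule finite_SL2[OF fin])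
    show "(order R - 1) * (order R)\<^sup>2 \<le> order (SL2 R)"
      using order_SL2_ge[OF fin] by (simp add: order_def)
    show "card (centralizer_of (SL2 R) x) \<le> order R + 1"
      if "x \<in> carrier (SL2 R)" "x \<noteq> \<one>\<^bsub>SL2 R\<^esub>" for x
      using card_centralizer_SL2[OF fin that] by (simp add: order_def)
    show "(\<one>, \<one>, \<zero>, \<one>) \<in> carrier (SL2 R)" by (simp add: SL2_iff)
    show "(\<one>, \<one>, \<zero>, \<one>) \<noteq> \<one>\<^bsub>SL2 R\<^esub>" by (simp add: SL2_def)
    show "card (centralizer_of (SL2 R) (\<one>, \<one>, \<zero>, \<one>)) = order R"
      unfolding unip order_def by (rule card_image) (simp add: inj_on_def)
    fix y assume "y \<in> centralizer_of (SL2 R) (\<one>, \<one>, \<zero>, \<one>) - {\<one>\<^bsub>SL2 R\<^esub>}"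
    then obtain f where "f \<in> carrier R" "f \<noteq> \<zero>" "y = (\<one>, f, \<zero>, \<one>)"
      unfolding unip by (auto simp: SL2_def)
    then show "centralizer_of (SL2 R) y = centralizer_of (SL2 R) (\<one>, \<one>, \<zero>, \<one>)"
      by (simp add: unip centralizer_unipotent)
  qed
qed

text \<open>Factoring by the trivial subgroup makes every coset a singleton, so
  \<open>the_elem\<close> is an isomorphism onto \<open>SL2 R\<close>. Its inverse is taken, since
  the conditions are verified in \<open>SL2 R\<close> and moved to the quotient.\<close>

lemma (in field_char_2) iso_SL2_PSL2:
  obtains h where "h \<in> iso (SL2 R) (PSL2 R)" "group (PSL2 R)"
proof -
  interpret S: group "SL2 R" by (rule group_SL2)
  have grp: "group (PSL2 R)"
    unfolding PSL2_def scalar_SL2_eq by (rule normal.factorgroup_is_group[OF S.one_is_normal])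
  have "the_elem \<in> iso (PSL2 R) (SL2 R)"
    unfolding PSL2_def scalar_SL2_eq by (rule S.trivial_factor_iso)
  from group.iso_set_sym[OF grp this] grp show thesis by (rule that)
qed

lemma (in field) thin_PSL2:
  assumes "order R = 2 ^ k" "2 \<le> k"
  shows "\<exists>a. thin_centralizer_group (PSL2 R) (2 ^ k) a"
proof -
  interpret field_char_2 R by (rule char_2_of_order[OF assms(1)])
  obtain h where "h \<in> iso (SL2 R) (PSL2 R)" "group (PSL2 R)" by (rule iso_SL2_PSL2)
  moreover have "4 \<le> order R"
    using power_increasing[OF assms(2), of "2 :: nat"] assms(1) by simp
  ultimately show ?thesis
    using thin_centralizer_group_iso[OF thin_SL2] assms(1) by auto
qed

section \<open>Bounds on the mixing time and absence of cutoff\<close>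

theorem theorem4p4:
  shows "(\<forall>(k::nat) (R :: 'a ring). k \<ge> 2 \<longrightarrow> field R \<longrightarrow> order R = 2 ^ k \<longrightarrow>
            (2 ^ k + 1) / 4 \<le> real (commuting_mixing_time (PSL2 R) (1 / 4)) \<and>
            int (commuting_mixing_time (PSL2 R) (1 / 4)) \<le> \<lceil>(2 ^ k + 1) * ln (16::real) + 2\<rceil>)
       \<and> (\<forall>F :: nat \<Rightarrow> 'a ring. (\<forall>k\<ge>2. field (F k) \<and> order (F k) = 2 ^ k) \<longrightarrow>
            \<not> exhibits_cutoff (\<lambda>k. commuting_mixing_time (PSL2 (F k))))"
proof (intro conjI allI impI)
  fix k :: nat and R :: "'a ring"
  assume k: "k \<ge> 2" and R: "field R" "order R = 2 ^ k"
  obtain a where "thin_centralizer_group (PSL2 R) (2 ^ k) a"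
    using field.thin_PSL2[OF R k] by auto
  then interpret thin_centralizer_group "PSL2 R" "2 ^ k" a .
  show "(2 ^ k + 1) / 4 \<le> real (commuting_mixing_time (PSL2 R) (1 / 4))"
    using mixing_time_quarter_ge by simp
  show "int (commuting_mixing_time (PSL2 R) (1 / 4)) \<le> \<lceil>(2 ^ k + 1) * ln (16::real) + 2\<rceil>"
    using mixing_time_quarter_le by simp
next
  fix F :: "nat \<Rightarrow> 'a ring"
  assume F: "\<forall>k\<ge>2. field (F k) \<and> order (F k) = 2 ^ k"
  define r where "r k = real (commuting_mixing_time (PSL2 (F k)) (1 / 10))
    / real (commuting_mixing_time (PSL2 (F k)) (9 / 10))" for k
  \<comment> \<open>The threshold 4 on \<open>k\<close> ensures \<open>16 \<le> 2 ^ k\<close>, as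
    \<open>mixing_time_ratio\<close> requires. Staying at distance at least 1 from 1 contradicts
    convergence to 1.\<close>
  have far: "1 \<le> \<bar>r k - 1\<bar>" if k: "4 \<le> k" for k
  proof -
    have "field (F k)" "order (F k) = 2 ^ k" using F k by auto
    then obtain a where "thin_centralizer_group (PSL2 (F k)) (2 ^ k) a"
      using field.thin_PSL2[of "F k" k] k by auto
    then interpret thin_centralizer_group "PSL2 (F k)" "2 ^ k" a .
    have "(16 :: nat) \<le> 2 ^ k" using power_increasing[OF k, of "2 :: nat"] by simp
    from mixing_time_ratio[OF this] show ?thesis
      \<comment> \<open>if the denominator vanishes then \<open>r k = 0\<close>\<close>
      by (cases "commuting_mixing_time (PSL2 (F k)) (9 / 10) = 0") (auto simp: r_def field_simps)
  qed
  show "\<not> exhibits_cutoff (\<lambda>k. commuting_mixing_time (PSL2 (F k)))"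
  proof
    assume "exhibits_cutoff (\<lambda>k. commuting_mixing_time (PSL2 (F k)))"
    then have "(\<lambda>k. real (commuting_mixing_time (PSL2 (F k)) (1 / 10))
        / real (commuting_mixing_time (PSL2 (F k)) (1 - 1 / 10))) \<longlonglongrightarrow> 1"
      unfolding exhibits_cutoff_def by (rule bspec) simp
    then have "r \<longlonglongrightarrow> 1" unfolding r_def by simp
    then obtain n where "\<And>k. n \<le> k \<Longrightarrow> \<bar>r k - 1\<bar> < 1"
      using LIMSEQ_D[of r 1 1] by auto
    from this[of "max n 4"] far[of "max n 4"] show False by simp
  qed
qed

end
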